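(* Let $k$ and $l$ be integers with $2 \leq k \leq l$. Let $S_{\mathbb{R}}(k,l)$ denote the smallest real number $S$ such that for every coloring of the real numbers in the closed interval $[1,S]$ with the two colors red and blue, there is a red solution to $x_1 + x_2 + \cdots + x_k = x_0$ or a blue solution to $x_1 + x_2 + \cdots + x_l = x_0$. Then $S_{\mathbb{R}}(k,l) = kl + k - 1$.
   Context: A red (resp. blue) solution to an equation means real numbers $x_0, x_1, \dots$ in the colored interval satisfying the equation, all colored red (resp. blue); the variables need not be distinct. *)

theory Defs
  imports Complex_Main
begin

datatype color = Red | Blue

text \<open>
  A coloring of \<open>[1, S]\<close> is represented by a total function \<open>real \<Rightarrow> color\<close>, of which only the
  values on \<open>{1..S}\<close> are used.
\<close>

definition mono_solution :: "(real \<Rightarrow> color) \<Rightarrow> real \<Rightarrow> color \<Rightarrow> nat \<Rightarrow> (nat \<Rightarrow> real) \<Rightarrow> bool" where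
  "mono_solution c S q m x \<longleftrightarrow>
     (\<forall>i\<in>{0..m}. x i \<in> {1..S} \<and> c (x i) = q) \<and> (\<Sum>i=1..m. x i) = x 0"

definition forces_solution :: "nat \<Rightarrow> nat \<Rightarrow> real \<Rightarrow> bool" where
  "forces_solution k l S \<longleftrightarrow>
     (\<forall>c. (\<exists>x. mono_solution c S Red k x) \<or> (\<exists>x. mono_solution c S Blue l x))"

text \<open>
  \<open>Least\<close> on the reals is a definite description, so the existence of the minimum is not built
  into this definition and has to be asserted separately.
\<close>

definition S_R :: "nat \<Rightarrow> nat \<Rightarrow> real" where
  "S_R k l = (LEAST S. forces_solution k l S)"

end

theory Submission
  imports Defs
begin

text \<open>
  For \<open>S < kl + k - 1\<close>, colouring \<open>[k, kl)\<close> blue and the rest red avoids both kinds of solutions.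
  For \<open>S = kl + k - 1\<close>, suppose that a colouring has no solution; then each of the
  following colours is forced by the preceding ones.

  If \<open>1\<close> is red: \<open>k\<close> is blue, \<open>kl\<close> red, \<open>kl + k - 1\<close> and \<open>kl - k + 1\<close> blue, \<open>(k + 1) / 2\<close> red because
  \<open>(l - 2) k + 2 (k + 1) / 2 = kl - k + 1\<close>, then \<open>(3k - 1) / 2\<close> blue, and
  \<open>(l - 2) k + 2 (3k - 1) / 2 = kl + k - 1\<close> is a blue solution.

  If \<open>1\<close> is blue: \<open>l\<close> is red, \<open>kl\<close> blue, \<open>k\<close> red, \<open>k\<^sup>2\<close> blue, \<open>k\<^sup>2 + l - 1\<close> red,
  \<open>l + k - 1\<close> blue because \<open>(k - 1) k + (l + k - 1) = k\<^sup>2 + l - 1\<close>, \<open>k - 1\<close> red because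
  \<open>(l + k - 1) + (l - 1) (k - 1) = kl\<close>, \<open>k (k - 1)\<close> blue, \<open>k (k - 1) + l - 1\<close> red, and
  \<open>l + (k - 2) k + (k - 1) = k (k - 1) + l - 1\<close> is a red solution.
\<close>

text \<open>Every solution in the forcing argument repeats a few values, so exhibiting one reduces
  to a linear identity with multiplicities \<open>p\<close>, \<open>r\<close>, \<open>s\<close>. A
  value of multiplicity 0 must still have the right range and colour; callers fill that slot with a
  value known to qualify. Only the final red solution needs all three slots.\<close>

lemma mono_solution_of_three_values:
  assumes "a \<in> {1..S}" "b \<in> {1..S}" "d \<in> {1..S}" "t \<in> {1..S}"
    and "c a = q" "c b = q" "c d = q" "c t = q"
    and "p + r + s = m"
    and sum: "real p * a + real r * b + real s * d = t"
  shows "\<exists>x. mono_solution c S q m x"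
proof -
  define x where "x i = (if i = 0 then t else if i \<le> p then a else if i \<le> p + r then b else d)"
    for i :: nat
  have "{1..m} = {1..p} \<union> {p+1..p+r} \<union> {p+r+1..m}"
    using assms(9) by auto
  then have "(\<Sum>i=1..m. x i) = (\<Sum>i\<in>{1..p} \<union> {p+1..p+r} \<union> {p+r+1..m}. x i)"
    by simp
  also have "\<dots> = (\<Sum>i=1..p. x i) + (\<Sum>i=p+1..p+r. x i) + (\<Sum>i=p+r+1..m. x i)"
    by (subst sum.union_disjoint; (subst sum.union_disjoint)?) auto
  also have "\<dots> = (\<Sum>i=1..p. a) + (\<Sum>i=p+1..p+r. b) + (\<Sum>i=p+r+1..m. d)"
    by (intro arg_cong2[where f = "(+)"] sum.cong) (auto simp: x_def)
  also have "\<dots> = t"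
    using assms(9) sum by auto
  finally have "(\<Sum>i=1..m. x i) = x 0"
    by (simp add: x_def)
  then have "mono_solution c S q m x"
    using assms by (auto simp: mono_solution_def x_def)
  then show ?thesis
    by blast
qed

text \<open>A red summand that is at least \<open>k * l\<close>, with the other \<open>k - 1\<close>
  at least 1, pushes the sum beyond \<open>S\<close>. Otherwise all red summands lie in
  \<open>[1, k)\<close>, so their sum lies in \<open>[k, k * k)\<close>, which is blue since
  \<open>k \<le> l\<close>. Blue summands add up to at least \<open>k * l\<close>, above the blue
  range.\<close>

lemma forces_solution_lower_bound:
  fixes k l :: nat
  assumes "1 \<le> k" and "k \<le> l" and forces: "forces_solution k l S"
  shows "real k * real l + real k - 1 \<le> S"
proof (rule ccontr)
  assume "\<not> ?thesis"
  then have S: "S < real k * real l + real k - 1"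
    by simp
  define c where "c x = (if real k \<le> x \<and> x < real k * real l then Blue else Red)" for x
  consider x where "mono_solution c S Red k x" | x where "mono_solution c S Blue l x"
    using forces unfolding forces_solution_def by blast
  then show False
  proof cases
    case 1
    then have rng: "1 \<le> x i" "x i \<le> S" and red: "c (x i) = Red" if "i \<le> k" for i
      using that by (auto simp: mono_solution_def)
    have sum: "(\<Sum>i=1..k. x i) = x 0"
      using 1 by (simp add: mono_solution_def)
    show False
    proof (cases "\<exists>i\<in>{1..k}. real k * real l \<le> x i")
      case True
      then obtain j where j: "j \<in> {1..k}" "real k * real l \<le> x j"
        by blast
      have "real (card ({1..k} - {j})) * 1 \<le> (\<Sum>i\<in>{1..k} - {j}. x i)"
        by (rule sum_bounded_below) (use rng in auto)
      then have "real k - 1 \<le> (\<Sum>i\<in>{1..k} - {j}. x i)"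
        using j(1) \<open>1 \<le> k\<close> by (simp add: of_nat_diff)
      then have "real k * real l + real k - 1 \<le> x 0"
        using j sum by (simp add: sum.remove[of _ j])
      then show False
        using S rng(2)[of 0] by simp
    next
      case False
      then have less: "x i < real k" if "i \<in> {1..k}" for i
        using red[of i] that by (force simp: c_def split: if_splits)
      have "(\<Sum>i=1..k. x i) < (\<Sum>i=1..k. real k)"
        by (rule sum_strict_mono) (use less \<open>1 \<le> k\<close> in auto)
      then have "x 0 < real k * real k"
        using sum by simp
      also have "\<dots> \<le> real k * real l"
        using \<open>k \<le> l\<close> by (intro mult_left_mono) auto
      finally have "x 0 < real k * real l" .
      moreover have "real (card {1..k}) * 1 \<le> (\<Sum>i=1..k. x i)"
        by (rule sum_bounded_below) (use rng in auto)
      ultimately show False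
        using red[of 0] sum by (simp add: c_def)
    qed
  next
    case 2
    then have blue: "real k \<le> x i" "x i < real k * real l" if "i \<le> l" for i
      using that by (auto simp: mono_solution_def c_def split: if_splits)
    have "real (card {1..l}) * real k \<le> (\<Sum>i=1..l. x i)"
      by (rule sum_bounded_below) (use blue in auto)
    then show False
      using blue(2)[of 0] 2 by (simp add: mono_solution_def mult.commute)
  qed
qed

lemma forces_solution_upper_bound:
  fixes k l :: nat
  assumes "2 \<le> k" and "k \<le> l"
  shows "forces_solution k l (real k * real l + real k - 1)"
proof (rule ccontr)
  define S where "S = real k * real l + real k - 1"
  assume "\<not> forces_solution k l (real k * real l + real k - 1)"
  then obtain c where c: "\<nexists>x. mono_solution c S Red k x" "\<nexists>x. mono_solution c S Blue l x"
    unfolding forces_solution_def S_def by blast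
  define K L where "K = real k" and "L = real l"
  have KL: "2 \<le> K" "K \<le> L"
    using assms by (auto simp: K_def L_def)
  have S: "S = K * L + K - 1"
    by (simp add: S_def K_def L_def)
  have nat_diff: "real (k - 1) = K - 1" "real (k - 2) = K - 2"
      "real (l - 1) = L - 1" "real (l - 2) = L - 2"
    using assms by (auto simp: K_def L_def)
  \<comment> \<open>Expanded, this is exactly \<open>K * K + L - 1 \<le> S\<close>, the tightest
    range check in the blue case. With the bounds in \<open>prod\<close>, range checks become linear
    in the products.\<close>
  have "0 \<le> (K - 1) * (L - K)"
    using KL by simp
  then have prod: "K * K + L \<le> K * L + K" "2 * L \<le> K * L" "2 * K \<le> K * K"
    using KL by (auto simp: algebra_simps intro: mult_left_mono)
  \<comment> \<open>This forces the colour of a sum only. To force the colour of a summand, the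
    opposite colour is assumed and the sum, whose colour is known, gets the wrong one.\<close>
  have not_red: "c t = Blue"
    if "c a = Red" "c b = Red" "c d = Red" "p + r + s = k"
      "real p * a + real r * b + real s * d = t"
      "a \<in> {1..S}" "b \<in> {1..S}" "d \<in> {1..S}" "t \<in> {1..S}" for a b d t p r s
    using that c(1) mono_solution_of_three_values[of a S b d t c Red p r s k]
    by (cases "c t") auto
  have not_blue: "c t = Red"
    if "c a = Blue" "c b = Blue" "c d = Blue" "p + r + s = l"
      "real p * a + real r * b + real s * d = t"
      "a \<in> {1..S}" "b \<in> {1..S}" "d \<in> {1..S}" "t \<in> {1..S}" for a b d t p r s
    using that c(2) mono_solution_of_three_values[of a S b d t c Blue p r s l]
    by (cases "c t") auto
  have one: "1 \<in> {1..S}" and K: "K \<in> {1..S}" and L: "L \<in> {1..S}" and KL_in: "K * L \<in> {1..S}"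
    using KL prod unfolding S atLeastAtMost_iff by - (intro conjI; linarith)+
  show False
  proof (cases "c 1")
    case Red
    have "c K = Blue"
      by (rule not_red[of 1 1 1 k 0 0]) (use Red one K in \<open>auto simp: K_def\<close>)
    have "c (K * L) = Red"
      by (rule not_blue[of K K K l 0 0])
        (use \<open>c K = Blue\<close> K KL_in in \<open>auto simp: L_def\<close>)
    have S_in: "S \<in> {1..S}"
      using KL_in by auto
    have "c S = Blue"
      by (rule not_red[of "K * L" 1 1 1 "k - 1" 0])
        (use Red \<open>c (K * L) = Red\<close> one KL_in S_in assms nat_diff in \<open>auto simp: S\<close>)
    have A: "K * L - K + 1 \<in> {1..S}"
      using KL prod unfolding S atLeastAtMost_iff by (intro conjI; linarith)
    \<comment> \<open>Adding \<open>k - 1\<close> ones to this point gives the red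
      \<open>K * L\<close>.\<close>
    have "c (K * L - K + 1) = Blue"
    proof (rule ccontr)
      assume "c (K * L - K + 1) \<noteq> Blue"
      then have "c (K * L - K + 1) = Red"
        by (cases "c (K * L - K + 1)") auto
      then have "c (K * L) = Blue"
        by (intro not_red[of "K * L - K + 1" 1 1 1 "k - 1" 0])
          (use Red A one KL_in assms nat_diff in auto)
      then show False
        using \<open>c (K * L) = Red\<close> by simp
    qed
    \<comment> \<open>For even \<open>k\<close> this point is not an integer: here the colouring of
      the reals is used.\<close>
    have B: "(K + 1) / 2 \<in> {1..S}"
      using KL K by auto
    have "c ((K + 1) / 2) = Red"
    proof (rule ccontr)
      assume "c ((K + 1) / 2) \<noteq> Red"
      then have "c ((K + 1) / 2) = Blue"
        by (cases "c ((K + 1) / 2)") auto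
      then have "c (K * L - K + 1) = Red"
        by (intro not_blue[of "(K + 1) / 2" K K 2 "l - 2" 0])
          (use \<open>c K = Blue\<close> A B K assms nat_diff in \<open>auto simp: algebra_simps\<close>)
      then show False
        using \<open>c (K * L - K + 1) = Blue\<close> by simp
    qed
    have "2 * K \<le> S"
      using KL prod unfolding S by linarith
    then have D: "(3 * K - 1) / 2 \<in> {1..S}"
      using KL by auto
    \<comment> \<open>The point is \<open>(K + 1) / 2\<close> plus \<open>k - 1\<close>
      ones.\<close>
    have "c ((3 * K - 1) / 2) = Blue"
      by (rule not_red[of "(K + 1) / 2" 1 1 1 "k - 1" 0])
        (use Red \<open>c ((K + 1) / 2) = Red\<close> B D one assms nat_diff in \<open>auto simp: field_simps\<close>)
    then have "c S = Red"
      by (intro not_blue[of "(3 * K - 1) / 2" K K 2 "l - 2" 0])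
        (use \<open>c K = Blue\<close> D K S_in assms nat_diff in \<open>auto simp: S field_simps\<close>)
    then show False
      using \<open>c S = Blue\<close> by simp
  next
    case Blue
    have "c L = Red"
      by (rule not_blue[of 1 1 1 l 0 0]) (use Blue one L in \<open>auto simp: L_def\<close>)
    have "c (K * L) = Blue"
      by (rule not_red[of L L L k 0 0])
        (use \<open>c L = Red\<close> L KL_in in \<open>auto simp: K_def\<close>)
    have "c K = Red"
    proof (rule ccontr)
      assume "c K \<noteq> Red"
      then have "c K = Blue"
        by (cases "c K") auto
      then have "c (K * L) = Red"
        by (intro not_blue[of K K K l 0 0]) (use K KL_in in \<open>auto simp: L_def\<close>)
      then show False
        using \<open>c (K * L) = Blue\<close> by simp
    qed
    have KK: "K * K \<in> {1..S}"
      using KL prod unfolding S atLeastAtMost_iff by (intro conjI; linarith)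
    have "c (K * K) = Blue"
      by (rule not_red[of K K K k 0 0]) (use \<open>c K = Red\<close> K KK in \<open>auto simp: K_def\<close>)
    have A: "K * K + L - 1 \<in> {1..S}"
      using KL prod unfolding S atLeastAtMost_iff by (intro conjI; linarith)
    have "c (K * K + L - 1) = Red"
      by (rule not_blue[of "K * K" 1 1 1 "l - 1" 0])
        (use Blue \<open>c (K * K) = Blue\<close> KK one A assms nat_diff in auto)
    have B: "L + K - 1 \<in> {1..S}"
      using KL prod unfolding S atLeastAtMost_iff by (intro conjI; linarith)
    have "c (L + K - 1) = Blue"
    proof (rule ccontr)
      assume "c (L + K - 1) \<noteq> Blue"
      then have "c (L + K - 1) = Red"
        by (cases "c (L + K - 1)") auto
      then have "c (K * K + L - 1) = Blue"
        by (intro not_red[of "L + K - 1" K K 1 "k - 1" 0])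
          (use \<open>c K = Red\<close> K A B assms nat_diff in \<open>auto simp: algebra_simps\<close>)
      then show False
        using \<open>c (K * K + L - 1) = Red\<close> by simp
    qed
    \<comment> \<open>For \<open>k = 2\<close> this point is 1, which is blue, so the red colour
      forced below is already absurd; the chain covers that case without a split.\<close>
    have D: "K - 1 \<in> {1..S}"
      using KL K by auto
    have "c (K - 1) = Red"
    proof (rule ccontr)
      assume "c (K - 1) \<noteq> Red"
      then have "c (K - 1) = Blue"
        by (cases "c (K - 1)") auto
      then have "c (K * L) = Red"
        by (intro not_blue[of "L + K - 1" "K - 1" "K - 1" 1 "l - 1" 0])
          (use \<open>c (L + K - 1) = Blue\<close> B D KL_in assms nat_diff in \<open>auto simp: algebra_simps\<close>)
      then show False
        using \<open>c (K * L) = Blue\<close> by simp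
    qed
    have E: "K * (K - 1) \<in> {1..S}" and F: "K * (K - 1) + L - 1 \<in> {1..S}"
      using KL prod unfolding S atLeastAtMost_iff right_diff_distrib by - (intro conjI; linarith)+
    have "c (K * (K - 1)) = Blue"
      by (rule not_red[of "K - 1" "K - 1" "K - 1" k 0 0])
        (use \<open>c (K - 1) = Red\<close> D E in \<open>auto simp: K_def\<close>)
    then have "c (K * (K - 1) + L - 1) = Red"
      by (intro not_blue[of "K * (K - 1)" 1 1 1 "l - 1" 0])
        (use Blue E F one assms nat_diff in auto)
    moreover have "c (K * (K - 1) + L - 1) = Blue"
      by (rule not_red[of L "K - 1" K 1 1 "k - 2"])
        (use \<open>c L = Red\<close> \<open>c (K - 1) = Red\<close> \<open>c K = Red\<close> L D K F assms nat_diff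
          in \<open>auto simp: algebra_simps\<close>)
    ultimately show False
      by simp
  qed
qed

theorem theorem1:
  fixes k l :: nat
  assumes "2 \<le> k" and "k \<le> l"
  shows "forces_solution k l (S_R k l)
       \<and> (\<forall>S. forces_solution k l S \<longrightarrow> S_R k l \<le> S)
       \<and> S_R k l = real k * real l + real k - 1"
proof -
  have upper: "forces_solution k l (real k * real l + real k - 1)"
    using assms by (rule forces_solution_upper_bound)
  have lower: "real k * real l + real k - 1 \<le> S" if "forces_solution k l S" for S
    using forces_solution_lower_bound[OF _ _ that] assms by simp
  have "S_R k l = real k * real l + real k - 1"
    unfolding S_R_def using upper lower by (rule Least_equality)
  then show ?thesis
    using upper lower by simp
qed

end
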